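(* Let $B>0$, $P>0$, $P_{\mathrm{N,Tx}}\ge 0$, $c_1>0$ and $c_2>0$. For a power allocation factor $\alpha\in[0,1]$, i.e. $P_{\mathrm{D}}=\alpha P$ and $P_{\mathrm{R}}=(1-\alpha)P$ with $0\le P_{\mathrm{D}}\le P$ and $0\le P_{\mathrm{R}}\le P$, the upper-bounded rate is $$R_{\mathrm{upper}}(\alpha)=B\Big(\log_2\big(1+(1-\alpha)Pc_1\big)+\log_2\big(1+\alpha Pc_2\big)\Big).$$ Then the optimal power allocation factor, i.e. the value of $\alpha$ that maximizes $R_{\mathrm{upper}}(\alpha)$ over $0\le\alpha\le 1$ subject to the exposure constraint $\alpha\le \dfrac{P_{\mathrm{N,Tx}}}{P}$, is $$\min\left\{\frac{P_{\mathrm{N,Tx}}}{P},\ \frac{Pc_2-Pc_1+P^2c_1c_2}{2\left(P^2c_1c_2\right)}\right\}.$$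
   Context: A base station (BS) with $N_{\mathrm{T}}$ antennas transmits with total power $P$ to a single-antenna intended user (IU) over two links: a direct link with channel $\bm{h}_{\mathrm{D}}\in\mathbb{C}^{1\times N_{\mathrm{T}}}$, unit-norm precoder $\bm{w}_{\mathrm{D}}$ and power $P_{\mathrm{D}}$, and a link assisted by a reconfigurable intelligent surface (RIS) with $N$ elements, with effective channel $\bm{h}_{\mathrm{RI}}\bm{\Theta}\bm{h}_{\mathrm{BR}}$ (where $\bm{h}_{\mathrm{BR}}\in\mathbb{C}^{N\times N_{\mathrm{T}}}$, $\bm{h}_{\mathrm{RI}}\in\mathbb{C}^{1\times N}$ and $\bm{\Theta}=\mathrm{diag}(e^{j\phi_1},\dots,e^{j\phi_N})$), unit-norm precoder $\bm{w}_{\mathrm{R}}$ and power $P_{\mathrm{R}}$, with $0\le P_{\mathrm{D}}\le P$, $0\le P_{\mathrm{R}}\le P$ and $P_{\mathrm{D}}+P_{\mathrm{R}}=P$. Here $B$ is the bandwidth and $N_0$ the noise power spectral density. The average received signal-to-noise ratios with optimized BS and RIS beamforming are $$c_1=\frac{\mathbb{E}\big[|\bm{h}_{\mathrm{RI}}\bm{\Theta}\bm{h}_{\mathrm{BR}}\bm{w}_{\mathrm{R}}|^2\big]}{BN_0},\qquad c_2=\frac{\mathbb{E}\big[|\bm{h}_{\mathrm{D}}\bm{w}_{\mathrm{D}}|^2\big]}{BN_0}.$$ The constant $P_{\mathrm{N,Tx}}$ is the largest power that the direct link may use without violating the electromagnetic field exposure constraint at a non-intended user. The function $R_{\mathrm{upper}}$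 is the upper bound on the IU rate when different codewords are sent on the direct link and on the RIS link (one logarithm per link), written in terms of $c_1$ and $c_2$.
   Formalization: The displayed value can fall outside [0,1] (e.g. P=1, c_1=1, c_2=0.1, P_{N,Tx}=1 gives -4), so it is proved to be the unique maximizer when it lies in [0,1]; for all parameters the unique maximizer is shown to be that value clipped to [0,1]. *)

theory Defs
  imports Complex_Main
begin

definition R_upper :: "real \<Rightarrow> real \<Rightarrow> real \<Rightarrow> real \<Rightarrow> real \<Rightarrow> real" where
  "R_upper B P c1 c2 \<alpha> = B * (log 2 (1 + (1 - \<alpha>) * P * c1) + log 2 (1 + \<alpha> * P * c2))"

definition feasible_alloc :: "real \<Rightarrow> real \<Rightarrow> real \<Rightarrow> bool" where
  "feasible_alloc P P_NTx \<alpha> \<longleftrightarrow> 0 \<le> \<alpha> \<and> \<alpha> \<le> 1 \<and> \<alpha> \<le> P_NTx / P"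

definition optimal_alloc :: "real \<Rightarrow> real \<Rightarrow> real \<Rightarrow> real \<Rightarrow> real \<Rightarrow> real \<Rightarrow> bool" where
  "optimal_alloc B P P_NTx c1 c2 \<alpha> \<longleftrightarrow>
     is_arg_max (R_upper B P c1 c2) (feasible_alloc P P_NTx) \<alpha>"

text \<open>The second argument of \<open>min\<close> is the stationary point of the rate; it may be negative or exceed 1
  for admissible parameters, so this closed form is not feasible for every choice of them.\<close>

definition alloc_formula :: "real \<Rightarrow> real \<Rightarrow> real \<Rightarrow> real \<Rightarrow> real" where
  "alloc_formula P P_NTx c1 c2 =
     min (P_NTx / P) ((P * c2 - P * c1 + P\<^sup>2 * c1 * c2) / (2 * (P\<^sup>2 * c1 * c2)))"

end

theory Submission
  imports Defs
begin

text \<open>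
  The sum of the two logarithms is the logarithm of a concave quadratic in \<open>\<alpha>\<close>. Completing the
  square shows that, on \<open>[0, 1]\<close>, the rate is larger the closer \<open>\<alpha>\<close> is to the vertex of this
  parabola. Hence the unique maximiser is the point of the feasible interval nearest to the vertex.
\<close>

lemma R_upper_less_iff:
  fixes B P c1 c2 a b :: real
  defines "s \<equiv> (P * c2 - P * c1 + P\<^sup>2 * c1 * c2) / (2 * (P\<^sup>2 * c1 * c2))"
  assumes pos: "B > 0" "P > 0" "c1 > 0" "c2 > 0"
    and a: "0 \<le> a" "a \<le> 1" and b: "0 \<le> b" "b \<le> 1"
  shows "R_upper B P c1 c2 a < R_upper B P c1 c2 b \<longleftrightarrow> \<bar>b - s\<bar> < \<bar>a - s\<bar>"
proof -
  define D where "D = P\<^sup>2 * c1 * c2"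
  have D: "D > 0" using pos by (simp add: D_def)
  \<comment> \<open>Expanding the product of the two log arguments gives linear coefficient
    \<open>2 * D * s\<close> and leading coefficient \<open>- D\<close>, so \<open>s\<close> is the
    vertex.\<close>
  have Ds: "2 * D * s = P * c2 - P * c1 + D"
    using D unfolding s_def D_def[symmetric] by simp
  define Q where "Q t = (1 + (1 - t) * P * c1) * (1 + t * P * c2)" for t
  have vertex: "Q t = 1 + P * c1 + D * s\<^sup>2 - D * (t - s)\<^sup>2" for t
  proof -
    have "Q t = 1 + P * c1 + t * (P * c2 - P * c1 + D) - D * t\<^sup>2"
      unfolding Q_def D_def by (simp add: algebra_simps power2_eq_square)
    also have "\<dots> = 1 + P * c1 + D * s\<^sup>2 - D * (t - s)\<^sup>2"
      unfolding Ds[symmetric] by (simp add: algebra_simps power2_eq_square)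
    finally show ?thesis .
  qed
  \<comment> \<open>The range of \<open>t\<close> makes both factors positive, so the logarithms
    merge; the identity \<open>vertex\<close> holds for all real \<open>t\<close>.\<close>
  have Q: "Q t > 0" "R_upper B P c1 c2 t = B * log 2 (Q t)" if "0 \<le> t" "t \<le> 1" for t
  proof -
    have "1 + (1 - t) * P * c1 > 0" "1 + t * P * c2 > 0"
      using that pos by (simp_all add: add_pos_nonneg)
    then show "Q t > 0" "R_upper B P c1 c2 t = B * log 2 (Q t)"
      by (simp_all add: Q_def R_upper_def log_mult)
  qed
  have "R_upper B P c1 c2 a < R_upper B P c1 c2 b \<longleftrightarrow> Q a < Q b"
    using Q a b pos by simp
  also have "\<dots> \<longleftrightarrow> (b - s)\<^sup>2 < (a - s)\<^sup>2"
    using D by (simp add: vertex)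
  also have "\<dots> \<longleftrightarrow> \<bar>b - s\<bar> < \<bar>a - s\<bar>"
    by (simp add: abs_le_square_iff flip: not_le)
  finally show ?thesis .
qed

text \<open>\<open>is_arg_max\<close> only forbids strictly better points: \<open>m\<close> itself
  rules out every rival, and asymmetry keeps any rival from beating \<open>m\<close>.\<close>

lemma is_arg_max_unique:
  fixes f :: "'a \<Rightarrow> 'b::order"
  assumes "S m" and "\<And>x. S x \<Longrightarrow> x \<noteq> m \<Longrightarrow> f x < f m"
  shows "is_arg_max f S x \<longleftrightarrow> x = m"
  using assms unfolding is_arg_max_def by (metis order.asym order.irrefl)

theorem lemma1:
  fixes B P P_NTx c1 c2 :: real
  assumes "B > 0" and "P > 0" and "P_NTx \<ge> 0" and "c1 > 0" and "c2 > 0"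
  shows "(alloc_formula P P_NTx c1 c2 \<in> {0..1} \<longrightarrow>
            (\<forall>\<alpha>. optimal_alloc B P P_NTx c1 c2 \<alpha> \<longleftrightarrow> \<alpha> = alloc_formula P P_NTx c1 c2))
       \<and> (\<forall>\<alpha>. optimal_alloc B P P_NTx c1 c2 \<alpha> \<longleftrightarrow>
            \<alpha> = max 0 (min 1 (alloc_formula P P_NTx c1 c2)))"
proof -
  define s where "s = (P * c2 - P * c1 + P\<^sup>2 * c1 * c2) / (2 * (P\<^sup>2 * c1 * c2))"
  define p where "p = P_NTx / P"
  \<comment> \<open>Since \<open>p\<close> \<ge> 0, this is the projection of \<open>s\<close> onto
    the feasible interval from 0 to \<open>min 1 p\<close>, written as a clamp of the closed
    form.\<close>
  define m where "m = max 0 (min 1 (min p s))"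
  have p: "p \<ge> 0" using assms by (simp add: p_def)
  have formula: "alloc_formula P P_NTx c1 c2 = min p s"
    by (simp add: alloc_formula_def p_def s_def)
  have feasible: "feasible_alloc P P_NTx x \<longleftrightarrow> 0 \<le> x \<and> x \<le> 1 \<and> x \<le> p" for x
    by (simp add: feasible_alloc_def p_def)
  have m: "feasible_alloc P P_NTx m"
    using p by (auto simp: feasible m_def)
  have "R_upper B P c1 c2 x < R_upper B P c1 c2 m"
    if x: "feasible_alloc P P_NTx x" "x \<noteq> m" for x
  proof -
    \<comment> \<open>The projection is strictly nearer to \<open>s\<close> than any other point of
      the interval; the cases are the position of \<open>s\<close> relative to the
      endpoints.\<close>
    have "\<bar>m - s\<bar> < \<bar>x - s\<bar>"
      using x p unfolding feasible m_def by (auto simp: min_def max_def abs_if split: if_splits)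
    then show ?thesis
      using R_upper_less_iff[of B P c1 c2 x m] assms x m by (simp add: feasible s_def)
  qed
  then have "optimal_alloc B P P_NTx c1 c2 \<alpha> \<longleftrightarrow> \<alpha> = m" for \<alpha>
    unfolding optimal_alloc_def using m by (intro is_arg_max_unique)
  \<comment> \<open>If \<open>min p s\<close> lies in the unit interval, the clamp leaves it
    unchanged, which yields the first conjunct.\<close>
  then show ?thesis
    by (auto simp: formula m_def)
qed

end
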